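(* There is a universal constant $C>0$ such that the following holds. Let $m\ge2$, $n\ge1$, $\Omega=\{0,1,\dots,m-1\}$, and let $\pi$ be a probability distribution on $\Omega$ with full support. Let $\phi_0,\dots,\phi_{m-1}:\Omega\to\mathbb{R}$, with $\phi_0=1$, be an orthonormal basis of $L^2(\Omega,\pi)$. Let $f,g:\Omega^n\to\mathbb{R}$ be monotone functions with $\|f\|\le1$ and $\|g\|\le1$. Then $$\mathbb{E}[fg]-\mathbb{E}[f]\,\mathbb{E}[g]\;\ge\;\frac1C\cdot\Phi\left(\sum_{\#\alpha=1}\widehat f(\alpha)\widehat g(\alpha)\right),$$ where the sum is over $\alpha\in\{0,\dots,m-1\}^n$ with $\#\alpha=1$, expectations are under $\pi^{\otimes n}$, and $\Phi:[0,1]\to[0,1]$ is $\Phi(x)=\min\left\{x,\frac{x}{\log^2(1/x)}\right\}$.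
   Context: $L^2(\Omega^n,\pi^{\otimes n})$ has inner product $\langle f,g\rangle=\mathbb{E}_{x\sim\pi^{\otimes n}}[f(x)g(x)]$ and norm $\|f\|=\langle f,f\rangle^{1/2}$. A function $f:\Omega^n\to\mathbb{R}$ is monotone if $f(x)\le f(y)$ whenever $x_i\le y_i$ for all $i\in[n]$. For $\alpha\in\{0,\dots,m-1\}^n$, $\#\alpha=|\{i:\alpha_i\ne0\}|$, $\phi_\alpha(x)=\prod_{i=1}^n\phi_{\alpha_i}(x_i)$, and $\widehat f(\alpha)=\langle f,\phi_\alpha\rangle$; the $\phi_\alpha$ form an orthonormal basis of $L^2(\Omega^n,\pi^{\otimes n})$. Conventions for $\Phi$: $\Phi(0)=0$, $\Phi(1)=1$. The inequality is read as including that the argument of $\Phi$ lies in its domain $[0,1]$. *)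

theory Defs
  imports "HOL-Probability.Probability"
begin

text \<open>
  \<open>\<Omega> = {0,\<dots>,m-1}\<close> is the set \<open>{..<m}\<close> of naturals. Points of \<open>\<Omega>\<^sup>n\<close>, and likewise
  multi-indices in \<open>{0,\<dots>,m-1}\<^sup>n\<close>, are functions on \<open>{..<n}\<close>, extended by the
  value \<^term>\<open>undefined\<close> outside \<open>{..<n}\<close>.
\<close>

definition cube :: "nat \<Rightarrow> nat \<Rightarrow> (nat \<Rightarrow> nat) set" where
  "cube m n = {..<n} \<rightarrow>\<^sub>E {..<m}"

definition cube_pmf :: "nat \<Rightarrow> nat pmf \<Rightarrow> (nat \<Rightarrow> nat) pmf" where
  "cube_pmf n p = Pi_pmf {..<n} undefined (\<lambda>_. p)"

lemma set_cube_pmf: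
  assumes "set_pmf p = {..<m}"
  shows "set_pmf (cube_pmf n p) = cube m n"
  using assms unfolding cube_pmf_def cube_def
  by (auto simp: set_Pi_pmf PiE_dflt_def PiE_def extensional_def Pi_def)

definition L2_inner :: "'a pmf \<Rightarrow> ('a \<Rightarrow> real) \<Rightarrow> ('a \<Rightarrow> real) \<Rightarrow> real" where
  "L2_inner p f g = measure_pmf.expectation p (\<lambda>x. f x * g x)"

definition L2_norm :: "'a pmf \<Rightarrow> ('a \<Rightarrow> real) \<Rightarrow> real" where
  "L2_norm p f = sqrt (L2_inner p f f)"

text \<open>
  An orthonormal basis \<open>\<phi> 0, \<dots>, \<phi> (m-1)\<close> of \<open>L\<^sup>2\<close>, for a distribution of finite support;
  elements of \<open>L\<^sup>2\<close> are identified when they agree on the support.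
\<close>

definition orthonormal_basis :: "'a pmf \<Rightarrow> nat \<Rightarrow> (nat \<Rightarrow> 'a \<Rightarrow> real) \<Rightarrow> bool" where
  "orthonormal_basis p m \<phi> \<longleftrightarrow>
     (\<forall>j<m. \<forall>k<m. L2_inner p (\<phi> j) (\<phi> k) = (if j = k then 1 else 0)) \<and>
     (\<forall>h. \<exists>c :: nat \<Rightarrow> real. \<forall>x\<in>set_pmf p. h x = (\<Sum>j<m. c j * \<phi> j x))"

definition monotone_cube :: "nat \<Rightarrow> nat \<Rightarrow> ((nat \<Rightarrow> nat) \<Rightarrow> real) \<Rightarrow> bool" where
  "monotone_cube m n f \<longleftrightarrow>
     (\<forall>x\<in>cube m n. \<forall>y\<in>cube m n. (\<forall>i<n. x i \<le> y i) \<longrightarrow> f x \<le> f y)"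

definition num_nonzero :: "nat \<Rightarrow> (nat \<Rightarrow> nat) \<Rightarrow> nat" where
  "num_nonzero n \<alpha> = card {i. i < n \<and> \<alpha> i \<noteq> 0}"

definition basis_fun :: "nat \<Rightarrow> (nat \<Rightarrow> nat \<Rightarrow> real) \<Rightarrow> (nat \<Rightarrow> nat) \<Rightarrow> (nat \<Rightarrow> nat) \<Rightarrow> real" where
  "basis_fun n \<phi> \<alpha> x = (\<Prod>i<n. \<phi> (\<alpha> i) (x i))"

definition fourier_coeff ::
  "nat \<Rightarrow> nat pmf \<Rightarrow> (nat \<Rightarrow> nat \<Rightarrow> real) \<Rightarrow> ((nat \<Rightarrow> nat) \<Rightarrow> real) \<Rightarrow> (nat \<Rightarrow> nat) \<Rightarrow> real" where
  "fourier_coeff n p \<phi> f \<alpha> = L2_inner (cube_pmf n p) f (basis_fun n \<phi> \<alpha>)"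

text \<open>
  \<open>\<Phi>\<close> is meant on \<open>[0,1]\<close> only. The endpoint values are set by hand: at 1 division by
  zero would otherwise give 0 instead of the intended value 1. The logarithm is natural.
\<close>

definition Phi :: "real \<Rightarrow> real" where
  "Phi x = (if x = 0 then 0 else if x = 1 then 1 else min x (x / (ln (1 / x))\<^sup>2))"

end

theory Submission
  imports Defs
begin

text \<open>
  Let \<open>q(t) = \<Sum>\<^sub>\<alpha> t\<^bsup>#\<alpha>\<^esup> f^(\<alpha>) g^(\<alpha>)\<close>. Completeness of the basis turns \<open>q(t)\<close> into
  \<open>E[f(x) g(y)]\<close> for a coupling \<open>(x, y)\<close> that is independent over the coordinates; moving
  the noise rates one coordinate at a time, Chebyshev's sum inequality shows that \<open>q\<close> is
  increasing from \<open>q(0) = E[f] E[g]\<close> to \<open>q(1) = E[fg]\<close>. By Parseval the coefficients of \<open>q\<close>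
  are absolutely summable with sum at most 1, so on \<open>[0, 1/2]\<close> the terms of degree above \<open>d\<close>
  contribute at most \<open>2\<^bsup>-d\<^esup>\<close>. A Markov-type bound on the derivative at 0 of polynomials of
  degree \<open>d\<close> then yields \<open>W \<le> 8 d\<^sup>2 (q(1) - q(0) + 2\<^bsup>-d\<^esup>)\<close> for the coefficient \<open>W\<close> of \<open>t\<close>,
  and one chooses \<open>d\<close> of order \<open>1 + ln (1/W)\<close>.
\<close>

section \<open>Numerical differentiation at 0 by central differences\<close>

text \<open>An \<open>N\<close>-th finite difference kills polynomials of degree below
  \<open>N\<close>. In the induction one factor \<open>x + i\<close> is split; absorbing
  \<open>i\<close> into the binomial coefficient leaves a sum of the same kind for
  \<open>N - 1\<close> and \<open>x + 1\<close>, so both \<open>N\<close> and \<open>x\<close> must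
  vary.\<close>

lemma alternating_binomial_power_sum:
  fixes x :: real
  assumes "r < N"
  shows "(\<Sum>i\<le>N. (-1) ^ i * real (N choose i) * (x + real i) ^ r) = 0"
  using assms
proof (induction r arbitrary: N x)
  case 0
  then show ?case using choose_alternating_sum[of N, where ?'a = real] by simp
next
  case (Suc r)
  then obtain N' where N: "N = Suc N'" and r: "r < N'" by (cases N) auto
  have "(\<Sum>i\<le>N. (-1) ^ i * real (N choose i) * (real i * (x + real i) ^ r))
      = (\<Sum>i\<le>N'. (-1) ^ Suc i * (real (Suc i) * real (Suc N' choose Suc i)) * (x + real (Suc i)) ^ r)"
    unfolding N sum.atMost_Suc_shift by (simp add: mult_ac)
  also have "\<dots> = (\<Sum>i\<le>N'. - real N * ((-1) ^ i * real (N' choose i) * ((x + 1) + real i) ^ r))"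
  proof (intro sum.cong refl)
    fix i
    have "real (Suc i) * real (Suc N' choose Suc i) = real N * real (N' choose i)"
      unfolding N of_nat_mult[symmetric] by (simp only: Suc_times_binomial_eq mult.commute)
    then show "(-1) ^ Suc i * (real (Suc i) * real (Suc N' choose Suc i)) * (x + real (Suc i)) ^ r
      = - real N * ((-1) ^ i * real (N' choose i) * ((x + 1) + real i) ^ r)"
      by (simp add: add_ac)
  qed
  also have "\<dots> = 0"
    using Suc.IH[OF r, of "x + 1"] by (simp only: sum_distrib_left[symmetric] mult_zero_right)
  finally have "(\<Sum>i\<le>N. (-1) ^ i * real (N choose i) * (real i * (x + real i) ^ r)) = 0" .
  moreover have "(\<Sum>i\<le>N. (-1) ^ i * real (N choose i) * (x + real i) ^ Suc r)
     = x * (\<Sum>i\<le>N. (-1) ^ i * real (N choose i) * (x + real i) ^ r)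
       + (\<Sum>i\<le>N. (-1) ^ i * real (N choose i) * (real i * (x + real i) ^ r))"
    by (simp add: sum_distrib_left sum.distrib[symmetric] algebra_simps)
  ultimately show ?case using Suc.IH[of N x] Suc.prems by simp
qed

text \<open>A difference of order \<open>2 * d\<close> is applied to the even power
  \<open>2 * r\<close> at the nodes \<open>-d, ..., d\<close>. Opposite nodes contribute equally,
  and the middle node contributes only for \<open>r = 0\<close>, since
  \<open>0 ^ 0 = 1\<close>.\<close>

lemma central_binomial_power_sum:
  assumes "r < d"
  shows "2 * (\<Sum>j=1..d. (-1) ^ (j + 1) * real (2 * d choose (d + j)) * real j ^ (2 * r))
           = (if r = 0 then real (2 * d choose d) else 0)"
proof -
  define h where "h i = (-1) ^ i * real (2 * d choose i) * (- real d + real i) ^ (2 * r)" for i :: nat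
  define s where "s = (\<Sum>j=1..d. (-1) ^ (j + 1) * real (2 * d choose (d + j)) * real j ^ (2 * r))"
  have up: "(\<Sum>i\<in>{d<..2*d}. h i) = - ((-1) ^ d) * s"
  proof -
    have "(\<Sum>i\<in>{d<..2*d}. h i) = (\<Sum>j=1..d. h (d + j))"
      by (rule sum.reindex_bij_witness[of _ "\<lambda>j. d + j" "\<lambda>i. i - d"]) auto
    then show ?thesis
      unfolding s_def sum_distrib_left
      by (auto intro!: sum.cong simp: h_def power_add)
  qed
  have down: "(\<Sum>i\<in>{..<d}. h i) = - ((-1) ^ d) * s"
  proof -
    have "(\<Sum>i\<in>{..<d}. h i) = (\<Sum>j=1..d. h (d - j))"
      by (rule sum.reindex_bij_witness[of _ "\<lambda>j. d - j" "\<lambda>i. d - i"]) auto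
    also have "\<dots> = (\<Sum>j=1..d. - ((-1) ^ d) * ((-1) ^ (j + 1) * real (2 * d choose (d + j)) * real j ^ (2 * r)))"
    proof (intro sum.cong refl)
      fix j assume j: "j \<in> {1..d}"
      have "2 * d choose (d - j) = 2 * d choose (d + j)"
        using j binomial_symmetric[of "d - j" "2 * d"] by (simp add: mult_2)
      moreover have "(-1 :: real) ^ (d - j) = (-1) ^ d * (-1) ^ j"
        using j by (auto simp: minus_one_power_iff)
      ultimately show "h (d - j) = - ((-1) ^ d) * ((-1) ^ (j + 1) * real (2 * d choose (d + j)) * real j ^ (2 * r))"
        using j by (simp add: h_def of_nat_diff)
    qed
    finally show ?thesis by (simp add: s_def sum_distrib_left)
  qed
  have "{..2*d} = {..<d} \<union> {d} \<union> {d<..2*d}" by auto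
  then have "(\<Sum>i\<le>2*d. h i) = (\<Sum>i\<in>{..<d}. h i) + h d + (\<Sum>i\<in>{d<..2*d}. h i)"
    by (simp only:) (subst sum.union_disjoint; auto)+
  moreover have "(\<Sum>i\<le>2*d. h i) = 0"
    unfolding h_def using assms by (intro alternating_binomial_power_sum) simp
  moreover have "h d = (-1) ^ d * (if r = 0 then real (2 * d choose d) else 0)"
    by (simp add: h_def)
  ultimately have "(-1) ^ d * (2 * s) = (-1) ^ d * (if r = 0 then real (2 * d choose d) else 0)"
    using up down by (simp add: algebra_simps)
  then show ?thesis by (simp add: s_def)
qed

lemma sum_inverse_squares_le: "(\<Sum>j=1..d. 1 / (real j)\<^sup>2) \<le> 2"
proof -
  \<comment> \<open>The subtracted term makes the induction telescope; starting at
    \<open>Suc d\<close> avoids division by zero.\<close>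
  have "(\<Sum>j=1..Suc d. 1 / (real j)\<^sup>2) \<le> 2 - 1 / real (Suc d)" for d
  proof (induction d)
    case (Suc d)
    have "1 / (real (Suc (Suc d)))\<^sup>2 \<le> 1 / (real (Suc d) * real (Suc (Suc d)))"
      unfolding power2_eq_square by (intro divide_left_mono mult_right_mono) auto
    also have "\<dots> = 1 / real (Suc d) - 1 / real (Suc (Suc d))"
      by (simp add: field_simps)
    finally show ?case using Suc by simp
  qed simp
  from this[of "d - 1"] show ?thesis by (cases d) (auto intro: order_trans)
qed

text \<open>
  Numerical differentiation at 0. In the variable \<open>s = \<surd>t\<close> the nodes are equispaced and the
  formula is the symmetric difference quotient for the second derivative of an even polynomial;
  this is what makes the total weight quadratic in \<open>d\<close>.
\<close>

lemma derivative_at_zero_quadrature: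
  assumes "d \<ge> 1"
  obtains w :: "nat \<Rightarrow> real" where
    "\<And>k. 1 \<le> k \<Longrightarrow> k \<le> d \<Longrightarrow> (\<Sum>j=1..d. w j * ((real j / real d)\<^sup>2) ^ k) = (if k = 1 then 1 else 0)"
    "(\<Sum>j=1..d. \<bar>w j\<bar>) \<le> 4 * (real d)\<^sup>2"
proof
  define B where "B = real (2 * d choose d)"
  have B: "B > 0" by (simp add: B_def)
  \<comment> \<open>These are central difference coefficients normalised by the middle one. The
    factor \<open>d^2 / j^2\<close> turns the moment of order \<open>k\<close> into the central sum
    with \<open>r = k - 1\<close>, which is nonzero only for \<open>k = 1\<close>.\<close>
  define w where "w j = (-1) ^ (j + 1) * 2 * real (2 * d choose (d + j)) / B * ((real d)\<^sup>2 / (real j)\<^sup>2)"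
    for j :: nat
  show "(\<Sum>j=1..d. w j * ((real j / real d)\<^sup>2) ^ k) = (if k = 1 then 1 else 0)"
    if "1 \<le> k" "k \<le> d" for k
  proof -
    obtain r where r: "k = Suc r" "r < d" using \<open>1 \<le> k\<close> \<open>k \<le> d\<close> by (cases k) auto
    have "w j * ((real j / real d)\<^sup>2) ^ k
        = 2 / (B * real d ^ (2 * r)) * ((-1) ^ (j + 1) * real (2 * d choose (d + j)) * real j ^ (2 * r))"
      if "j \<in> {1..d}" for j
    proof -
      have "(real d)\<^sup>2 / (real j)\<^sup>2 * ((real j / real d)\<^sup>2) ^ k = real j ^ (2 * r) / real d ^ (2 * r)"
        using that assms by (simp add: r power_mult power_divide power_mult_distrib)
      then show ?thesis
        by (simp only: w_def mult.assoc) simp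
    qed
    then have "(\<Sum>j=1..d. w j * ((real j / real d)\<^sup>2) ^ k) = 1 / (B * real d ^ (2 * r)) *
        (2 * (\<Sum>j=1..d. (-1) ^ (j + 1) * real (2 * d choose (d + j)) * real j ^ (2 * r)))"
      by (simp add: sum_distrib_left)
    then show ?thesis
      unfolding central_binomial_power_sum[OF r(2)] using B by (simp add: r B_def)
  qed
  \<comment> \<open>The central binomial coefficient is the largest, so only inverse squares remain.
    At \<open>j = 0\<close> both sides are 0 by the convention for division by zero.\<close>
  have "\<bar>w j\<bar> \<le> 2 * (real d)\<^sup>2 * (1 / (real j)\<^sup>2)" for j
  proof -
    have "real (2 * d choose (d + j)) \<le> B"
      unfolding B_def using binomial_maximum[of "2 * d" "d + j"] by simp
    then have "real (2 * d choose (d + j)) / B * (2 * ((real d)\<^sup>2 / (real j)\<^sup>2))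
        \<le> 1 * (2 * ((real d)\<^sup>2 / (real j)\<^sup>2))"
      using B by (intro mult_right_mono) auto
    then show ?thesis
      using B by (simp add: w_def abs_mult mult_ac)
  qed
  then have "(\<Sum>j=1..d. \<bar>w j\<bar>) \<le> 2 * (real d)\<^sup>2 * (\<Sum>j=1..d. 1 / (real j)\<^sup>2)"
    unfolding sum_distrib_left by (rule sum_mono)
  also have "\<dots> \<le> 2 * (real d)\<^sup>2 * 2"
    by (intro mult_left_mono sum_inverse_squares_le) simp
  finally show "(\<Sum>j=1..d. \<bar>w j\<bar>) \<le> 4 * (real d)\<^sup>2" by simp
qed

section \<open>Bounds on the linear coefficient of a polynomial\<close>

text \<open>The quadrature is applied to \<open>t \<mapsto> q(t / 2) - q(0)\<close>. Its values at
  the nodes contribute at most \<open>4 * d^2 * M\<close>; halving the argument damps degrees above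
  \<open>d\<close> by at least \<open>2^(-d)\<close>, at the cost of halving the linear coefficient,
  whence the factor 8.\<close>

lemma linear_part_le:
  fixes c :: "'a \<Rightarrow> real" and deg :: "'a \<Rightarrow> nat"
  assumes "finite A" and c1: "(\<Sum>\<alpha>\<in>A. \<bar>c \<alpha>\<bar>) \<le> 1"
    and q: "\<And>t. 0 \<le> t \<Longrightarrow> t \<le> 1 \<Longrightarrow>
      \<bar>(\<Sum>\<alpha>\<in>A. c \<alpha> * t ^ deg \<alpha>) - (\<Sum>\<alpha>\<in>A. c \<alpha> * 0 ^ deg \<alpha>)\<bar> \<le> M"
    and d: "d \<ge> 1"
  shows "(\<Sum>\<alpha> | \<alpha> \<in> A \<and> deg \<alpha> = 1. c \<alpha>) \<le> 8 * (real d)\<^sup>2 * (M + (1 / 2) ^ d)"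
proof -
  obtain w where
    w: "\<And>k. 1 \<le> k \<Longrightarrow> k \<le> d \<Longrightarrow> (\<Sum>j=1..d. w j * ((real j / real d)\<^sup>2) ^ k) = (if k = 1 then 1 else 0)"
    and wsum: "(\<Sum>j=1..d. \<bar>w j\<bar>) \<le> 4 * (real d)\<^sup>2"
    by (rule derivative_at_zero_quadrature[OF d]) blast
  define \<tau> where "\<tau> j = (real j / real d)\<^sup>2" for j
  have \<tau>: "0 \<le> \<tau> j" "\<tau> j \<le> 1" if "j \<in> {1..d}" for j
    using that by (auto simp: \<tau>_def intro!: power_le_one)
  define q0 where "q0 t = (\<Sum>\<alpha>\<in>A. c \<alpha> * t ^ deg \<alpha>) - (\<Sum>\<alpha>\<in>A. c \<alpha> * 0 ^ deg \<alpha>)" for t :: real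
  \<comment> \<open>The quadrature value of the monomial of degree \<open>k\<close> after halving
    the argument: \<open>1 / 2\<close> for \<open>k = 1\<close>, zero for
    \<open>2 \<le> k \<le> d\<close>, and small for \<open>k > d\<close>.\<close>
  define e where "e k = (1 / 2) ^ k * (\<Sum>j=1..d. w j * \<tau> j ^ k)" for k
  have q0: "\<bar>q0 (\<tau> j / 2)\<bar> \<le> M" if "j \<in> {1..d}" for j
    unfolding q0_def using \<tau>[OF that] by (intro q) auto
  have "M \<ge> 0" using q[of 0] by simp
  have q0_eq: "q0 t = (\<Sum>\<alpha> | \<alpha> \<in> A \<and> deg \<alpha> \<noteq> 0. c \<alpha> * t ^ deg \<alpha>)" for t
    unfolding q0_def sum_subtractf[symmetric] using \<open>finite A\<close>
    by (intro sum.mono_neutral_cong_right) auto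
  have "(\<Sum>j=1..d. w j * q0 (\<tau> j / 2)) = (\<Sum>\<alpha> | \<alpha> \<in> A \<and> deg \<alpha> \<noteq> 0. c \<alpha> * e (deg \<alpha>))"
    unfolding q0_eq e_def sum_distrib_left
    by (subst sum.swap) (simp add: power_divide mult_ac)
  also have "\<dots> = (\<Sum>\<alpha>\<in>{\<alpha>\<in>A. deg \<alpha> = 1} \<union> {\<alpha>\<in>A. deg \<alpha> > d}. c \<alpha> * e (deg \<alpha>))"
    using \<open>finite A\<close> w
    by (intro sum.mono_neutral_right) (auto simp: e_def \<tau>_def not_less Suc_le_eq)
  also have "\<dots> = (\<Sum>\<alpha>\<in>{\<alpha>\<in>A. deg \<alpha> = 1}. c \<alpha> * e (deg \<alpha>)) + (\<Sum>\<alpha>\<in>{\<alpha>\<in>A. deg \<alpha> > d}. c \<alpha> * e (deg \<alpha>))"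
    using \<open>finite A\<close> d by (intro sum.union_disjoint) auto
  also have "(\<Sum>\<alpha>\<in>{\<alpha>\<in>A. deg \<alpha> = 1}. c \<alpha> * e (deg \<alpha>)) = (\<Sum>\<alpha> | \<alpha> \<in> A \<and> deg \<alpha> = 1. c \<alpha>) / 2"
    using w[of 1] d by (simp add: e_def \<tau>_def sum_divide_distrib)
  finally have eq: "(\<Sum>\<alpha> | \<alpha> \<in> A \<and> deg \<alpha> = 1. c \<alpha>) / 2
      = (\<Sum>j=1..d. w j * q0 (\<tau> j / 2)) - (\<Sum>\<alpha>\<in>{\<alpha>\<in>A. deg \<alpha> > d}. c \<alpha> * e (deg \<alpha>))"
    by simp
  have "\<bar>\<Sum>j=1..d. w j * q0 (\<tau> j / 2)\<bar> \<le> (\<Sum>j=1..d. \<bar>w j\<bar> * M)"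
    using q0 by (intro order_trans[OF sum_abs] sum_mono) (auto simp: abs_mult intro!: mult_left_mono)
  also have "\<dots> \<le> 4 * (real d)\<^sup>2 * M"
    unfolding sum_distrib_right[symmetric] using wsum \<open>M \<ge> 0\<close> by (intro mult_right_mono)
  finally have main: "\<bar>\<Sum>j=1..d. w j * q0 (\<tau> j / 2)\<bar> \<le> 4 * (real d)\<^sup>2 * M" .
  have e: "\<bar>e k\<bar> \<le> (1 / 2) ^ d * (4 * (real d)\<^sup>2)" if "k > d" for k
  proof -
    have "\<bar>\<Sum>j=1..d. w j * \<tau> j ^ k\<bar> \<le> (\<Sum>j=1..d. \<bar>w j\<bar>)"
      using \<tau> by (intro order_trans[OF sum_abs] sum_mono)
        (auto simp: abs_mult power_abs intro!: mult_left_le power_le_one)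
    then have "\<bar>\<Sum>j=1..d. w j * \<tau> j ^ k\<bar> \<le> 4 * (real d)\<^sup>2" using wsum by linarith
    moreover have "(1 / 2 :: real) ^ k \<le> (1 / 2) ^ d"
      using that by (intro power_decreasing) auto
    ultimately show ?thesis
      unfolding e_def abs_mult power_abs by (intro mult_mono) auto
  qed
  have "\<bar>\<Sum>\<alpha>\<in>{\<alpha>\<in>A. deg \<alpha> > d}. c \<alpha> * e (deg \<alpha>)\<bar>
      \<le> (\<Sum>\<alpha>\<in>{\<alpha>\<in>A. deg \<alpha> > d}. \<bar>c \<alpha>\<bar> * ((1 / 2) ^ d * (4 * (real d)\<^sup>2)))"
    using e by (intro order_trans[OF sum_abs] sum_mono) (auto simp: abs_mult intro!: mult_left_mono)
  also have "\<dots> \<le> (\<Sum>\<alpha>\<in>A. \<bar>c \<alpha>\<bar> * ((1 / 2) ^ d * (4 * (real d)\<^sup>2)))"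
    using \<open>finite A\<close> by (intro sum_mono2) auto
  also have "\<dots> \<le> 1 * ((1 / 2) ^ d * (4 * (real d)\<^sup>2))"
    unfolding sum_distrib_right[symmetric] using c1 by (intro mult_right_mono) auto
  finally have err: "\<bar>\<Sum>\<alpha>\<in>{\<alpha>\<in>A. deg \<alpha> > d}. c \<alpha> * e (deg \<alpha>)\<bar> \<le> 4 * (real d)\<^sup>2 * (1 / 2) ^ d"
    by (simp add: mult_ac)
  show ?thesis using eq main err unfolding abs_le_iff by (simp add: algebra_simps)
qed

text \<open>Terms of degree at least 2 sum to at most \<open>t^2\<close>, so dividing the increment
  of the polynomial by \<open>t\<close> gives \<open>- t \<le> W\<close> for every \<open>t\<close>
  in \<open>(0, 1]\<close>.\<close>

lemma linear_part_nonneg: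
  fixes c :: "'a \<Rightarrow> real" and deg :: "'a \<Rightarrow> nat"
  assumes "finite A" and c1: "(\<Sum>\<alpha>\<in>A. \<bar>c \<alpha>\<bar>) \<le> 1"
    and q: "\<And>t. 0 \<le> t \<Longrightarrow> t \<le> 1 \<Longrightarrow>
      (\<Sum>\<alpha>\<in>A. c \<alpha> * 0 ^ deg \<alpha>) \<le> (\<Sum>\<alpha>\<in>A. c \<alpha> * t ^ deg \<alpha>)"
  shows "0 \<le> (\<Sum>\<alpha> | \<alpha> \<in> A \<and> deg \<alpha> = 1. c \<alpha>)"
proof -
  define W where "W = (\<Sum>\<alpha> | \<alpha> \<in> A \<and> deg \<alpha> = 1. c \<alpha>)"
  have "- t \<le> W" if t: "0 < t" "t \<le> 1" for t
  proof -
    have pw: "t ^ k \<le> t\<^sup>2" if "k \<ge> 2" for k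
      using t that by (intro power_decreasing) auto
    have "0 \<le> (\<Sum>\<alpha>\<in>A. c \<alpha> * t ^ deg \<alpha> - c \<alpha> * 0 ^ deg \<alpha>)"
      using q[of t] t by (simp add: sum_subtractf)
    also have "\<dots> \<le> (\<Sum>\<alpha>\<in>A. (if deg \<alpha> = 1 then c \<alpha> * t else 0) + \<bar>c \<alpha>\<bar> * t\<^sup>2)"
    proof (rule sum_mono)
      fix \<alpha>
      have "c \<alpha> * t ^ deg \<alpha> \<le> \<bar>c \<alpha>\<bar> * t\<^sup>2" if "deg \<alpha> \<ge> 2"
        using pw[OF that] t by (intro mult_mono) auto
      moreover have "deg \<alpha> = 0 \<or> deg \<alpha> = 1 \<or> deg \<alpha> \<ge> 2" by linarith
      ultimately show "c \<alpha> * t ^ deg \<alpha> - c \<alpha> * 0 ^ deg \<alpha> \<le> (if deg \<alpha> = 1 then c \<alpha> * t else 0) + \<bar>c \<alpha>\<bar> * t\<^sup>2"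
        by (auto simp: power_0_left)
    qed
    also have "\<dots> = W * t + (\<Sum>\<alpha>\<in>A. \<bar>c \<alpha>\<bar>) * t\<^sup>2"
      using \<open>finite A\<close>
      by (simp add: sum.distrib sum_distrib_right W_def flip: sum.inter_filter)
    also have "\<dots> \<le> W * t + 1 * t\<^sup>2"
      using c1 by (intro add_left_mono mult_right_mono) auto
    finally have "0 \<le> (W + t) * t" by (simp add: power2_eq_square algebra_simps)
    then show ?thesis using t by (simp add: zero_le_mult_iff)
  qed
  \<comment> \<open>For \<open>W < 0\<close> this value lies in \<open>(0, 1]\<close> and is smaller
    than \<open>- W\<close>, a contradiction.\<close>
  from this[of "min 1 (- W / 2)"] show ?thesis
    unfolding W_def[symmetric] by (cases "W < 0") auto
qed

section \<open>Choice of the degree and comparison with \<open>Phi\<close>\<close>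

lemma square_le_two_power: "n \<ge> 15 \<Longrightarrow> 64 * n\<^sup>2 \<le> (2::nat) ^ n"
proof (induction n rule: dec_induct)
  case (step n)
  have "15 * n \<le> n * n" using step by (intro mult_right_mono) auto
  then have "2 * n + 1 \<le> n * n" using step(1) by linarith
  then have "64 * (Suc n)\<^sup>2 \<le> 2 * (64 * n\<^sup>2)"
    by (simp add: power2_eq_square)
  then show ?case using step by simp
qed simp

text \<open>Taking \<open>d = 2 * n\<close> with \<open>n\<close> of order
  \<open>1 + ln (1 / W)\<close> makes the error term at most \<open>W / 2\<close>, which is moved to
  the left. What remains bounds \<open>W\<close> by a constant times
  \<open>(1 + ln (1 / W))^2 * M\<close>.\<close>

lemma Phi_le_of_quadratic_bounds:
  assumes W: "0 \<le> W" "W \<le> 1" and "M \<ge> 0"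
    and bd: "\<And>d. d \<ge> 1 \<Longrightarrow> W \<le> 8 * (real d)\<^sup>2 * (M + (1 / 2) ^ d)"
  shows "(1 / 65536) * Phi W \<le> M"
proof (cases "W = 0")
  case True
  then show ?thesis using \<open>M \<ge> 0\<close> by (simp add: Phi_def)
next
  case False
  then have "W > 0" using W by simp
  define L where "L = ln (1 / W)"
  have L: "L \<ge> 0" using W \<open>W > 0\<close> by (simp add: L_def)
  \<comment> \<open>The factor 15 ensures both \<open>n \<ge> 15\<close> and
    \<open>L \<le> n / 2\<close>, hence \<open>1 / W \<le> 2 ^ n\<close>. Rounding up costs at most
    \<open>1 + L\<close>, which gives the factor 16.\<close>
  define n where "n = nat \<lceil>15 * (1 + L)\<rceil>"
  have "real n = of_int \<lceil>15 * (1 + L)\<rceil>" using L by (simp add: n_def)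
  then have n1: "real n \<ge> 15 * (1 + L)" and n2: "real n \<le> 16 * (1 + L)"
    using L of_int_ceiling_le_add_one[of "15 * (1 + L)"] le_of_int_ceiling[of "15 * (1 + L)"]
    by (auto simp: algebra_simps)
  have "15 \<le> real n" using n1 L by simp
  then have n15: "n \<ge> 15" by linarith
  have "1 / W = exp L" using \<open>W > 0\<close> by (simp add: L_def)
  also have "\<dots> \<le> exp (real n * (1 / 2))" using n1 L by simp
  also have "\<dots> = exp (1 / 2) ^ n" by (rule exp_of_nat_mult)
  also have "\<dots> \<le> 2 ^ n" using exp_half_le2 by (intro power_mono) auto
  finally have W2: "1 \<le> W * 2 ^ n" using \<open>W > 0\<close> by (simp add: field_simps)
  have "64 * (real n)\<^sup>2 \<le> 2 ^ n"
    using of_nat_mono[OF square_le_two_power[OF n15], where ?'a = real] by simp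
  also have "\<dots> \<le> 2 ^ n * (W * 2 ^ n)"
    using mult_left_mono[OF W2, of "2 ^ n"] by simp
  finally have "64 * (real n)\<^sup>2 * (1 / 2) ^ (2 * n) \<le> W"
    by (simp add: power_divide field_simps power_mult power2_eq_square power_mult_distrib[symmetric])
  \<comment> \<open>For \<open>d = 2 * n\<close> the prefactor is \<open>32 * n^2\<close>, so the
    preceding estimate bounds the error by \<open>W / 2\<close>.\<close>
  with bd[of "2 * n"] n15 have "W \<le> 64 * (real n)\<^sup>2 * M"
    by (simp add: algebra_simps)
  also have "\<dots> \<le> 64 * (16 * (1 + L))\<^sup>2 * M"
    using n2 \<open>M \<ge> 0\<close> by (intro mult_right_mono mult_left_mono power_mono) auto
  finally have main: "W \<le> 16384 * (1 + L)\<^sup>2 * M"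
    unfolding power_mult_distrib by simp
  show ?thesis
  \<comment> \<open>The cases use the two arguments of the minimum in \<open>Phi\<close>:
    \<open>1 + L \<le> 2\<close> in the first and \<open>1 + L \<le> 2 * L\<close> in the second.
    The special value at \<open>W = 1\<close> falls into the first case.\<close>
  proof (cases "L \<le> 1")
    case True
    then have "(1 + L)\<^sup>2 \<le> 2\<^sup>2" using L by (intro power_mono) auto
    then have "16384 * (1 + L)\<^sup>2 * M \<le> 16384 * 2\<^sup>2 * M"
      using \<open>M \<ge> 0\<close> by (intro mult_right_mono) auto
    with main have "W \<le> 16384 * 2\<^sup>2 * M" by (rule order_trans)
    then have "W \<le> 65536 * M" by simp
    moreover have "Phi W \<le> W" by (simp add: Phi_def)
    ultimately show ?thesis by simp
  next
    case False
    then have "(1 + L)\<^sup>2 \<le> (2 * L)\<^sup>2" using L by (intro power_mono) auto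
    then have "16384 * (1 + L)\<^sup>2 * M \<le> 16384 * (2 * L)\<^sup>2 * M"
      using \<open>M \<ge> 0\<close> by (intro mult_right_mono) auto
    with main have "W \<le> 16384 * (2 * L)\<^sup>2 * M" by (rule order_trans)
    then have "W \<le> 65536 * L\<^sup>2 * M" by (simp add: power_mult_distrib)
    then have "W / L\<^sup>2 \<le> 65536 * M" using False by (simp add: field_simps)
    moreover have "Phi W \<le> W / L\<^sup>2"
      using \<open>W \<noteq> 0\<close> False by (auto simp: Phi_def L_def)
    ultimately show ?thesis by simp
  qed
qed

section \<open>The noise form and its monotonicity in the noise rates\<close>

lemma sum_PiE_insert:
  assumes "i \<notin> I"
  shows "(\<Sum>x\<in>PiE (insert i I) S. h x) = (\<Sum>x\<in>PiE I S. \<Sum>a\<in>S i. h (x(i := a)))"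
proof -
  have "(\<Sum>x\<in>PiE (insert i I) S. h x) = (\<Sum>(a, x)\<in>S i \<times> PiE I S. h (x(i := a)))"
    unfolding PiE_insert_eq
    by (subst sum.reindex[OF inj_combinator[OF assms]]) (simp add: case_prod_unfold o_def)
  also have "\<dots> = (\<Sum>a\<in>S i. \<Sum>x\<in>PiE I S. h (x(i := a)))"
    by (simp add: sum.cartesian_product)
  also have "\<dots> = (\<Sum>x\<in>PiE I S. \<Sum>a\<in>S i. h (x(i := a)))"
    by (rule sum.swap)
  finally show ?thesis .
qed

text \<open>
  The joint law of a letter and its copy which is kept with probability \<open>t\<close> and resampled
  otherwise.
\<close>

definition noise_weight :: "'a pmf \<Rightarrow> real \<Rightarrow> 'a \<Rightarrow> 'a \<Rightarrow> real" where
  "noise_weight p t a b = (1 - t) * pmf p a * pmf p b + (if a = b then t * pmf p a else 0)"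

text \<open>When \<open>S\<close> contains the support and the rates lie in \<open>[0, 1]\<close>,
  this is the expectation of \<open>f x * g y\<close> under the coupling. Each coordinate has its
  own rate so that rates can be changed one at a time.\<close>

definition noise_form ::
  "'a pmf \<Rightarrow> 'a set \<Rightarrow> 'i set \<Rightarrow> ('i \<Rightarrow> real) \<Rightarrow> (('i \<Rightarrow> 'a) \<Rightarrow> real) \<Rightarrow> (('i \<Rightarrow> 'a) \<Rightarrow> real) \<Rightarrow> real" where
  "noise_form p S I t f g =
     (\<Sum>x\<in>I \<rightarrow>\<^sub>E S. \<Sum>y\<in>I \<rightarrow>\<^sub>E S. f x * g y * (\<Prod>i\<in>I. noise_weight p (t i) (x i) (y i)))"

lemma noise_weight_nonneg: "0 \<le> t \<Longrightarrow> t \<le> 1 \<Longrightarrow> 0 \<le> noise_weight p t a b"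
  by (simp add: noise_weight_def)

text \<open>The weight is affine in \<open>t\<close>: it interpolates between independent letters
  and equal letters. The slope in \<open>t\<close> is thus a covariance when \<open>S\<close>
  contains the support.\<close>

lemma sum_noise_weight:
  assumes "finite S"
  shows "(\<Sum>a\<in>S. \<Sum>b\<in>S. u a * v b * noise_weight p t a b)
    = (1 - t) * ((\<Sum>a\<in>S. u a * pmf p a) * (\<Sum>a\<in>S. v a * pmf p a))
      + t * (\<Sum>a\<in>S. u a * v a * pmf p a)"
proof -
  have "(\<Sum>b\<in>S. u a * v b * noise_weight p t a b)
      = (1 - t) * (\<Sum>b\<in>S. u a * pmf p a * (v b * pmf p b)) + t * (u a * v a * pmf p a)"
    if "a \<in> S" for a
  proof -
    have "u a * v b * noise_weight p t a b = (1 - t) * (u a * pmf p a * (v b * pmf p b))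
      + (if a = b then t * (u a * v a * pmf p a) else 0)" for b
      by (simp add: noise_weight_def algebra_simps)
    then show ?thesis
      using assms that by (simp add: sum.distrib sum_distrib_left)
  qed
  then show ?thesis
    by (simp add: sum.distrib sum_product flip: sum_distrib_left)
qed

text \<open>Isolates the dependence on the single rate \<open>t i\<close>, with the remaining
  coordinates frozen.\<close>

lemma noise_form_insert:
  assumes "finite I" "i \<notin> I"
  shows "noise_form p S (insert i I) t f g =
    (\<Sum>x\<in>I \<rightarrow>\<^sub>E S. \<Sum>y\<in>I \<rightarrow>\<^sub>E S.
      (\<Sum>a\<in>S. \<Sum>b\<in>S. f (x(i := a)) * g (y(i := b)) * noise_weight p (t i) a b)
      * (\<Prod>j\<in>I. noise_weight p (t j) (x j) (y j)))"
proof -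
  have "noise_form p S (insert i I) t f g =
    (\<Sum>x\<in>I \<rightarrow>\<^sub>E S. \<Sum>a\<in>S. \<Sum>y\<in>I \<rightarrow>\<^sub>E S. \<Sum>b\<in>S. f (x(i := a)) * g (y(i := b)) *
      (\<Prod>j\<in>insert i I. noise_weight p (t j) ((x(i := a)) j) ((y(i := b)) j)))"
    unfolding noise_form_def by (simp only: sum_PiE_insert[OF assms(2)])
  also have "\<dots> =
    (\<Sum>x\<in>I \<rightarrow>\<^sub>E S. \<Sum>y\<in>I \<rightarrow>\<^sub>E S. \<Sum>a\<in>S. \<Sum>b\<in>S. f (x(i := a)) * g (y(i := b)) *
      (\<Prod>j\<in>insert i I. noise_weight p (t j) ((x(i := a)) j) ((y(i := b)) j)))"
    by (intro sum.cong refl sum.swap)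
  also have "\<dots> = (\<Sum>x\<in>I \<rightarrow>\<^sub>E S. \<Sum>y\<in>I \<rightarrow>\<^sub>E S.
      (\<Sum>a\<in>S. \<Sum>b\<in>S. f (x(i := a)) * g (y(i := b)) * noise_weight p (t i) a b)
      * (\<Prod>j\<in>I. noise_weight p (t j) (x j) (y j)))"
    unfolding sum_distrib_right
  proof (intro sum.cong refl)
    fix x y a b
    have "(\<Prod>j\<in>I. noise_weight p (t j) ((x(i := a)) j) ((y(i := b)) j))
        = (\<Prod>j\<in>I. noise_weight p (t j) (x j) (y j))"
      using assms by (intro prod.cong) auto
    then show "f (x(i := a)) * g (y(i := b)) *
        (\<Prod>j\<in>insert i I. noise_weight p (t j) ((x(i := a)) j) ((y(i := b)) j))
      = f (x(i := a)) * g (y(i := b)) * noise_weight p (t i) a b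
        * (\<Prod>j\<in>I. noise_weight p (t j) (x j) (y j))"
      using assms by (simp add: mult.assoc)
  qed
  finally show ?thesis .
qed

text \<open>Symmetrisation: \<open>(u a - u b) * (v a - v b)\<close> is nonnegative for monotone
  \<open>u\<close> and \<open>v\<close>, and its average over independent \<open>a\<close> and
  \<open>b\<close> is twice the covariance.\<close>

lemma chebyshev_sum_pmf:
  fixes p :: "'a::linorder pmf" and u v :: "'a \<Rightarrow> real"
  assumes "finite S" "set_pmf p \<subseteq> S" "mono_on S u" "mono_on S v"
  shows "(\<Sum>a\<in>S. u a * pmf p a) * (\<Sum>a\<in>S. v a * pmf p a) \<le> (\<Sum>a\<in>S. u a * v a * pmf p a)"
proof -
  have one: "(\<Sum>a\<in>S. pmf p a) = 1" using assms(1,2) by (rule sum_pmf_eq_1)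
  have "0 \<le> (\<Sum>a\<in>S. \<Sum>b\<in>S. pmf p a * pmf p b * ((u a - u b) * (v a - v b)))"
  proof (intro sum_nonneg mult_nonneg_nonneg[OF mult_nonneg_nonneg[OF pmf_nonneg pmf_nonneg]])
    fix a b assume "a \<in> S" "b \<in> S"
    then show "0 \<le> (u a - u b) * (v a - v b)"
      using assms(3,4)
      by (cases "a \<le> b") (auto simp: mono_on_def intro: mult_nonneg_nonneg mult_nonpos_nonpos)
  qed
  also have "\<dots> = (\<Sum>a\<in>S. \<Sum>b\<in>S. (u a * v a * pmf p a) * pmf p b + pmf p a * (u b * v b * pmf p b)
      - (u a * pmf p a) * (v b * pmf p b) - (v a * pmf p a) * (u b * pmf p b))"
    by (intro sum.cong refl) (simp add: algebra_simps)
  also have "\<dots> = 2 * ((\<Sum>a\<in>S. u a * v a * pmf p a)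
      - (\<Sum>a\<in>S. u a * pmf p a) * (\<Sum>a\<in>S. v a * pmf p a))"
    by (simp only: sum.distrib sum_subtractf sum_product[symmetric] one) (simp add: algebra_simps)
  finally show ?thesis by simp
qed

text \<open>With the other coordinates frozen, \<open>f\<close> and \<open>g\<close> are monotone in
  one letter. Raising the rate adds \<open>s - t i\<close> times a nonnegative covariance, averaged
  with nonnegative weights.\<close>

lemma noise_form_mono_coordinate:
  fixes p :: "'a::linorder pmf"
  assumes fin: "finite S" "finite I" and S: "set_pmf p \<subseteq> S" and i: "i \<in> I" "t i \<le> s"
    and t: "\<And>j. j \<in> I \<Longrightarrow> 0 \<le> t j \<and> t j \<le> 1"
    and f: "\<And>x y. \<lbrakk>x \<in> I \<rightarrow>\<^sub>E S; y \<in> I \<rightarrow>\<^sub>E S; \<forall>j\<in>I. x j \<le> y j\<rbrakk> \<Longrightarrow> f x \<le> f y"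
    and g: "\<And>x y. \<lbrakk>x \<in> I \<rightarrow>\<^sub>E S; y \<in> I \<rightarrow>\<^sub>E S; \<forall>j\<in>I. x j \<le> y j\<rbrakk> \<Longrightarrow> g x \<le> g y"
  shows "noise_form p S I t f g \<le> noise_form p S I (t(i := s)) f g"
proof -
  obtain J where J: "I = insert i J" "i \<notin> J" using i(1) by (meson Set.set_insert)
  then have "finite J" using fin by simp
  have eq: "(\<Prod>j\<in>J. noise_weight p ((t(i := s)) j) (x j) (y j))
      = (\<Prod>j\<in>J. noise_weight p (t j) (x j) (y j))" for x y
    using J by (intro prod.cong) auto
  show ?thesis
    unfolding J(1) noise_form_insert[OF \<open>finite J\<close> J(2)] eq
  proof (rule sum_mono, rule sum_mono, rule mult_right_mono)
    fix x y assume x: "x \<in> J \<rightarrow>\<^sub>E S" and y: "y \<in> J \<rightarrow>\<^sub>E S"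
    let ?u = "\<lambda>a. f (x(i := a))" and ?v = "\<lambda>a. g (y(i := a))"
    have "mono_on S ?u" "mono_on S ?v"
      using x y J by (auto simp: mono_on_def intro!: f g PiE_fun_upd)
    then have "0 \<le> (s - t i) * ((\<Sum>a\<in>S. ?u a * ?v a * pmf p a)
        - (\<Sum>a\<in>S. ?u a * pmf p a) * (\<Sum>a\<in>S. ?v a * pmf p a))"
      using chebyshev_sum_pmf[OF fin(1) S] i(2) by (intro mult_nonneg_nonneg) auto
    then show "(\<Sum>a\<in>S. \<Sum>b\<in>S. ?u a * ?v b * noise_weight p (t i) a b)
        \<le> (\<Sum>a\<in>S. \<Sum>b\<in>S. ?u a * ?v b * noise_weight p ((t(i := s)) i) a b)"
      unfolding sum_noise_weight[OF fin(1)] by (simp add: algebra_simps)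
  qed (use t J in \<open>auto intro!: prod_nonneg noise_weight_nonneg\<close>)
qed

lemma noise_form_mono:
  fixes p :: "'a::linorder pmf"
  assumes fin: "finite S" "finite I" and S: "set_pmf p \<subseteq> S"
    and st: "\<And>j. j \<in> I \<Longrightarrow> 0 \<le> s j \<and> s j \<le> t j \<and> t j \<le> 1"
    and f: "\<And>x y. \<lbrakk>x \<in> I \<rightarrow>\<^sub>E S; y \<in> I \<rightarrow>\<^sub>E S; \<forall>j\<in>I. x j \<le> y j\<rbrakk> \<Longrightarrow> f x \<le> f y"
    and g: "\<And>x y. \<lbrakk>x \<in> I \<rightarrow>\<^sub>E S; y \<in> I \<rightarrow>\<^sub>E S; \<forall>j\<in>I. x j \<le> y j\<rbrakk> \<Longrightarrow> g x \<le> g y"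
  shows "noise_form p S I s f g \<le> noise_form p S I t f g"
proof -
  \<comment> \<open>Hybrid rates: enlarging \<open>J\<close> by one coordinate at a time leads from
    \<open>s\<close> to \<open>t\<close>.\<close>
  define r where "r J j = (if j \<in> J then t j else s j)" for J j
  have "noise_form p S I s f g \<le> noise_form p S I (r J) f g" if "finite J" "J \<subseteq> I" for J
    using that
  proof (induction J rule: finite_induct)
    case empty
    then show ?case by (simp add: r_def)
  next
    case (insert i J)
    have eq: "r (insert i J) = (r J)(i := t i)" by (auto simp: r_def)
    have "noise_form p S I s f g \<le> noise_form p S I (r J) f g" using insert by simp
    also have "\<dots> \<le> noise_form p S I ((r J)(i := t i)) f g"
    proof (rule noise_form_mono_coordinate[OF fin S])
      show "i \<in> I" "r J i \<le> t i" using insert st by (auto simp: r_def)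
      show "0 \<le> r J j \<and> r J j \<le> 1" if "j \<in> I" for j
        using st[OF that] by (auto simp: r_def)
    qed (use f g in auto)
    finally show ?case unfolding eq .
  qed
  from this[of I] have "noise_form p S I s f g \<le> noise_form p S I (r I) f g" using fin by simp
  \<comment> \<open>\<open>r I\<close> and \<open>t\<close> need agree only on \<open>I\<close>,
    hence the congruence argument.\<close>
  also have "\<dots> = noise_form p S I t f g"
    unfolding noise_form_def r_def by (intro sum.cong refl arg_cong2[of _ _ _ _ "(*)"] prod.cong) auto
  finally show ?thesis .
qed

lemma noise_form_0:
  "noise_form p S I (\<lambda>_. 0) f g =
     (\<Sum>x\<in>I \<rightarrow>\<^sub>E S. f x * (\<Prod>i\<in>I. pmf p (x i))) * (\<Sum>x\<in>I \<rightarrow>\<^sub>E S. g x * (\<Prod>i\<in>I. pmf p (x i)))"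
proof -
  have "noise_weight p 0 a b = pmf p a * pmf p b" for a b
    by (simp add: noise_weight_def)
  then show ?thesis
    unfolding noise_form_def sum_product by (simp add: prod.distrib mult_ac)
qed

text \<open>At rate 1 a coordinate where \<open>x\<close> and \<open>y\<close> differ has weight 0,
  so only the diagonal survives.\<close>

lemma noise_form_1:
  assumes "finite S" "finite I"
  shows "noise_form p S I (\<lambda>_. 1) f g = (\<Sum>x\<in>I \<rightarrow>\<^sub>E S. f x * g x * (\<Prod>i\<in>I. pmf p (x i)))"
  unfolding noise_form_def
proof (intro sum.cong refl)
  fix x assume x: "x \<in> I \<rightarrow>\<^sub>E S"
  have "f x * g y * (\<Prod>i\<in>I. noise_weight p 1 (x i) (y i))
      = (if x = y then f x * g x * (\<Prod>i\<in>I. pmf p (x i)) else 0)" if y: "y \<in> I \<rightarrow>\<^sub>E S" for y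
  proof (cases "x = y")
    case False
    then obtain i where "i \<in> I" "x i \<noteq> y i"
      using PiE_ext[OF x y] by blast
    then have "(\<Prod>i\<in>I. noise_weight p 1 (x i) (y i)) = 0"
      using assms by (intro prod_zero bexI[of _ i]) (auto simp: noise_weight_def)
    then show ?thesis using False by simp
  qed (simp add: noise_weight_def)
  then have "(\<Sum>y\<in>I \<rightarrow>\<^sub>E S. f x * g y * (\<Prod>i\<in>I. noise_weight p 1 (x i) (y i)))
      = (\<Sum>y\<in>I \<rightarrow>\<^sub>E S. if x = y then f x * g x * (\<Prod>i\<in>I. pmf p (x i)) else 0)"
    by (rule sum.cong[OF refl])
  also have "\<dots> = f x * g x * (\<Prod>i\<in>I. pmf p (x i))"
    using x assms by (simp add: finite_PiE)
  finally show "(\<Sum>y\<in>I \<rightarrow>\<^sub>E S. f x * g y * (\<Prod>i\<in>I. noise_weight p 1 (x i) (y i)))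
      = f x * g x * (\<Prod>i\<in>I. pmf p (x i))" .
qed

section \<open>Fourier expansion of the noise form\<close>

text \<open>Spanning allows the indicator of \<open>b\<close> to be expanded in the basis;
  orthonormality identifies its coefficients as \<open>\<phi> k b * pmf p b\<close>. Evaluation at
  \<open>a\<close> gives the relation.\<close>

lemma orthonormal_basis_completeness:
  assumes "orthonormal_basis p m \<phi>" "finite (set_pmf p)" "a \<in> set_pmf p" "b \<in> set_pmf p"
  shows "(\<Sum>j<m. \<phi> j a * \<phi> j b) * pmf p b = (if a = b then 1 else 0)"
proof -
  have "\<forall>h. \<exists>c. \<forall>x\<in>set_pmf p. h x = (\<Sum>j<m. c j * \<phi> j x)"
    using assms(1) by (simp add: orthonormal_basis_def)
  from spec[OF this, of "\<lambda>x. if x = b then 1 else 0"]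
  obtain c where c: "\<And>x. x \<in> set_pmf p \<Longrightarrow> (if x = b then 1 else 0) = (\<Sum>j<m. c j * \<phi> j x)"
    by blast
  have L2: "L2_inner p u v = (\<Sum>x\<in>set_pmf p. u x * v x * pmf p x)" for u v
    unfolding L2_inner_def using assms(2) by (subst integral_measure_pmf_real) auto
  have "c k = \<phi> k b * pmf p b" if "k < m" for k
  proof -
    have "\<phi> k b * pmf p b = (\<Sum>x\<in>set_pmf p. (if x = b then 1 else 0) * \<phi> k x * pmf p x)"
      using assms by (simp add: if_distrib if_distribR cong: if_cong)
    also have "\<dots> = (\<Sum>x\<in>set_pmf p. (\<Sum>j<m. c j * \<phi> j x) * \<phi> k x * pmf p x)"
      using c by (intro sum.cong refl) simp
    also have "\<dots> = (\<Sum>j<m. c j * L2_inner p (\<phi> j) (\<phi> k))"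
      unfolding L2 sum_distrib_right sum_distrib_left by (subst sum.swap) (simp add: mult_ac)
    also have "\<dots> = (\<Sum>j<m. if j = k then c k else 0)"
      using assms(1) that by (intro sum.cong refl) (auto simp: orthonormal_basis_def)
    also have "\<dots> = c k" using that by simp
    finally show ?thesis by simp
  qed
  then show ?thesis
    using c[OF assms(3)] by (simp add: sum_distrib_left mult_ac)
qed

text \<open>This diagonalises the one-letter noise operator: eigenvalue 1 on constants and
  \<open>t\<close> on the rest of the basis. Writing 1 as \<open>(1 - t) + t\<close> at
  \<open>j = 0\<close> separates the independent part; completeness turns the rest into the diagonal
  part.\<close>

lemma noise_weight_spectral:
  assumes basis: "orthonormal_basis p m \<phi>" "finite (set_pmf p)"
    and one: "\<And>a. a \<in> set_pmf p \<Longrightarrow> \<phi> 0 a = 1" and "m > 0"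
    and ab: "a \<in> set_pmf p" "b \<in> set_pmf p"
  shows "noise_weight p t a b
    = (\<Sum>j<m. (if j = 0 then 1 else t) * (\<phi> j a * pmf p a) * (\<phi> j b * pmf p b))"
proof -
  have "(\<Sum>j<m. (if j = 0 then 1 else t) * (\<phi> j a * pmf p a) * (\<phi> j b * pmf p b))
     = (\<Sum>j<m. (if j = 0 then (1 - t) * pmf p a * pmf p b else 0)
         + t * pmf p a * (\<phi> j a * \<phi> j b * pmf p b))"
    using one ab by (intro sum.cong refl) (auto simp: algebra_simps)
  also have "\<dots> = (1 - t) * pmf p a * pmf p b + t * pmf p a * ((\<Sum>j<m. \<phi> j a * \<phi> j b) * pmf p b)"
    using \<open>m > 0\<close> by (simp add: sum.distrib sum_distrib_left sum_distrib_right)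
  also have "\<dots> = noise_weight p t a b"
    unfolding orthonormal_basis_completeness[OF basis ab] by (simp add: noise_weight_def)
  finally show ?thesis by simp
qed

lemma finite_cube: "finite (cube m n)"
  by (simp add: cube_def finite_PiE)

lemma expectation_cube_pmf:
  fixes h :: "(nat \<Rightarrow> nat) \<Rightarrow> real"
  assumes "set_pmf p = {..<m}"
  shows "measure_pmf.expectation (cube_pmf n p) h = (\<Sum>x\<in>cube m n. h x * (\<Prod>i<n. pmf p (x i)))"
proof -
  have "measure_pmf.expectation (cube_pmf n p) h = (\<Sum>x\<in>cube m n. h x * pmf (cube_pmf n p) x)"
    using set_cube_pmf[OF assms] by (intro integral_measure_pmf_real finite_cube) simp
  also have "\<dots> = (\<Sum>x\<in>cube m n. h x * (\<Prod>i<n. pmf p (x i)))"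
    unfolding cube_pmf_def by (intro sum.cong refl) (auto simp: pmf_Pi cube_def PiE_def extensional_def)
  finally show ?thesis .
qed

text \<open>Multiplying the one-letter expansions over the coordinates gives a sum over
  multi-indices, in which each nonzero entry of \<open>\<alpha>\<close> contributes one factor
  \<open>t\<close>. Exchanging sums then produces the Fourier coefficients.\<close>

lemma fourier_noise_form:
  assumes p: "set_pmf p = {..<m}" and "m > 0" and basis: "orthonormal_basis p m \<phi>"
    and one: "\<And>a. a < m \<Longrightarrow> \<phi> 0 a = 1"
  shows "(\<Sum>\<alpha>\<in>cube m n. fourier_coeff n p \<phi> f \<alpha> * fourier_coeff n p \<phi> g \<alpha> * t ^ num_nonzero n \<alpha>)
    = noise_form p {..<m} {..<n} (\<lambda>_. t) f g"
proof -
  let ?w = "\<lambda>j. if j = 0 then 1 else t" and ?\<psi> = "\<lambda>j a. \<phi> j a * pmf p a"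
  have coeff: "fourier_coeff n p \<phi> h \<alpha> = (\<Sum>x\<in>cube m n. h x * (\<Prod>i<n. ?\<psi> (\<alpha> i) (x i)))" for h \<alpha>
    unfolding fourier_coeff_def L2_inner_def expectation_cube_pmf[OF p] basis_fun_def
    by (simp add: prod.distrib mult.assoc)
  have pow: "t ^ num_nonzero n \<alpha> = (\<Prod>i<n. ?w (\<alpha> i))" for \<alpha>
    by (subst prod.If_cases) (auto simp: num_nonzero_def Int_def intro: arg_cong[where f = card])
  have prod: "(\<Prod>i<n. noise_weight p t (x i) (y i))
      = (\<Sum>\<alpha>\<in>cube m n. (\<Prod>i<n. ?w (\<alpha> i)) * (\<Prod>i<n. ?\<psi> (\<alpha> i) (x i)) * (\<Prod>i<n. ?\<psi> (\<alpha> i) (y i)))"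
    if "x \<in> cube m n" "y \<in> cube m n" for x y
  proof -
    have "(\<Prod>i<n. noise_weight p t (x i) (y i))
        = (\<Prod>i<n. \<Sum>j<m. ?w j * ?\<psi> j (x i) * ?\<psi> j (y i))"
      using that p one \<open>m > 0\<close>
      by (intro prod.cong refl noise_weight_spectral[OF basis]) (auto simp: cube_def PiE_def Pi_def)
    then show ?thesis
      by (simp add: prod_sum_PiE cube_def prod.distrib)
  qed
  have "noise_form p {..<m} {..<n} (\<lambda>_. t) f g = (\<Sum>x\<in>cube m n. \<Sum>y\<in>cube m n. \<Sum>\<alpha>\<in>cube m n.
      (f x * (\<Prod>i<n. ?\<psi> (\<alpha> i) (x i))) * (g y * (\<Prod>i<n. ?\<psi> (\<alpha> i) (y i))) * (\<Prod>i<n. ?w (\<alpha> i)))"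
    unfolding noise_form_def cube_def[symmetric]
  proof (rule sum.cong[OF refl], rule sum.cong[OF refl])
    fix x y assume "x \<in> cube m n" "y \<in> cube m n"
    from prod[OF this] show "f x * g y * (\<Prod>i<n. noise_weight p t (x i) (y i)) = (\<Sum>\<alpha>\<in>cube m n.
      (f x * (\<Prod>i<n. ?\<psi> (\<alpha> i) (x i))) * (g y * (\<Prod>i<n. ?\<psi> (\<alpha> i) (y i))) * (\<Prod>i<n. ?w (\<alpha> i)))"
      by (simp only: sum_distrib_left mult_ac)
  qed
  also have "\<dots> = (\<Sum>\<alpha>\<in>cube m n. \<Sum>x\<in>cube m n. \<Sum>y\<in>cube m n.
      (f x * (\<Prod>i<n. ?\<psi> (\<alpha> i) (x i))) * (g y * (\<Prod>i<n. ?\<psi> (\<alpha> i) (y i))) * (\<Prod>i<n. ?w (\<alpha> i)))"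
    by (subst (2) sum.swap, subst sum.swap) (rule refl)
  finally show ?thesis
    unfolding coeff pow sum_product unfolding sum_distrib_right by (rule sym)
qed

section \<open>The correlation inequality for monotone functions\<close>

theorem theorem38:
  shows "\<exists>C::real. C > 0 \<and>
    (\<forall>(m::nat) (n::nat) (p::nat pmf) (\<phi>::nat \<Rightarrow> nat \<Rightarrow> real)
      (f::(nat \<Rightarrow> nat) \<Rightarrow> real) (g::(nat \<Rightarrow> nat) \<Rightarrow> real).
      m \<ge> 2 \<longrightarrow> n \<ge> 1 \<longrightarrow>
      set_pmf p = {..<m} \<longrightarrow>
      orthonormal_basis p m \<phi> \<longrightarrow> (\<forall>a<m. \<phi> 0 a = 1) \<longrightarrow>
      monotone_cube m n f \<longrightarrow> monotone_cube m n g \<longrightarrow>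
      L2_norm (cube_pmf n p) f \<le> 1 \<longrightarrow> L2_norm (cube_pmf n p) g \<le> 1 \<longrightarrow>
      (let E = measure_pmf.expectation (cube_pmf n p);
           W = (\<Sum>\<alpha> | \<alpha> \<in> cube m n \<and> num_nonzero n \<alpha> = 1.
                  fourier_coeff n p \<phi> f \<alpha> * fourier_coeff n p \<phi> g \<alpha>)
       in W \<in> {0..1} \<and>
          E (\<lambda>x. f x * g x) - E f * E g \<ge> (1 / C) * Phi W))"
proof (intro exI[of _ "65536 :: real"] conjI allI impI)
  fix m n :: nat and p :: "nat pmf" and \<phi> :: "nat \<Rightarrow> nat \<Rightarrow> real" and f g :: "(nat \<Rightarrow> nat) \<Rightarrow> real"
  assume "m \<ge> 2" and p: "set_pmf p = {..<m}" and basis: "orthonormal_basis p m \<phi>"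
    and one: "\<forall>a<m. \<phi> 0 a = 1"
    and mono: "monotone_cube m n f" "monotone_cube m n g"
    and norm: "L2_norm (cube_pmf n p) f \<le> 1" "L2_norm (cube_pmf n p) g \<le> 1"
  define E :: "((nat \<Rightarrow> nat) \<Rightarrow> real) \<Rightarrow> real" where "E = measure_pmf.expectation (cube_pmf n p)"
  define F where "F = fourier_coeff n p \<phi>"
  define W where "W = (\<Sum>\<alpha> | \<alpha> \<in> cube m n \<and> num_nonzero n \<alpha> = 1. F f \<alpha> * F g \<alpha>)"
  \<comment> \<open>Arbitrary pairs are allowed because the diagonal pairs \<open>h, h\<close> at
    \<open>t = 1\<close> give Parseval.\<close>
  define Q where "Q h k t = noise_form p {..<m} {..<n} (\<lambda>_. t) h k" for h k t
  note Q_fourier = fourier_noise_form[OF p _ basis, of n, folded F_def Q_def]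
  have Q: "(\<Sum>\<alpha>\<in>cube m n. F h \<alpha> * F k \<alpha> * t ^ num_nonzero n \<alpha>) = Q h k t" for h k t
    using \<open>m \<ge> 2\<close> one by (intro Q_fourier) auto
  have Q0: "Q f g 0 = E f * E g"
    by (simp add: Q_def noise_form_0 E_def expectation_cube_pmf[OF p] cube_def)
  have Q1: "Q h k 1 = E (\<lambda>x. h x * k x)" for h k
    by (simp add: Q_def noise_form_1 E_def expectation_cube_pmf[OF p] cube_def)
  have Q_mono: "Q f g s \<le> Q f g t" if "0 \<le> s" "s \<le> t" "t \<le> 1" for s t
    unfolding Q_def using that mono p
    by (intro noise_form_mono) (auto simp: monotone_cube_def cube_def)
  have parseval: "(\<Sum>\<alpha>\<in>cube m n. (F h \<alpha>)\<^sup>2) \<le> 1" if "L2_norm (cube_pmf n p) h \<le> 1" for h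
    using that Q[of h h 1] by (simp add: Q1 E_def L2_norm_def L2_inner_def power2_eq_square)
  have l1: "(\<Sum>\<alpha>\<in>cube m n. \<bar>F f \<alpha> * F g \<alpha>\<bar>) \<le> 1"
  proof -
    \<comment> \<open>The inequality of arithmetic and geometric means reduces absolute summability
      to Parseval for \<open>f\<close> and for \<open>g\<close>.\<close>
    have "\<bar>F f \<alpha> * F g \<alpha>\<bar> \<le> ((F f \<alpha>)\<^sup>2 + (F g \<alpha>)\<^sup>2) / 2" for \<alpha>
      using sum_squares_bound[of "\<bar>F f \<alpha>\<bar>" "\<bar>F g \<alpha>\<bar>"] by (simp add: abs_mult)
    then have "(\<Sum>\<alpha>\<in>cube m n. \<bar>F f \<alpha> * F g \<alpha>\<bar>) \<le> (\<Sum>\<alpha>\<in>cube m n. ((F f \<alpha>)\<^sup>2 + (F g \<alpha>)\<^sup>2) / 2)"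
      by (rule sum_mono)
    also have "\<dots> \<le> 1"
      using parseval[OF norm(1)] parseval[OF norm(2)]
      by (simp add: sum_divide_distrib[symmetric] sum.distrib)
    finally show ?thesis .
  qed
  \<comment> \<open>Together with \<open>W1\<close> this places \<open>W\<close> in the domain of
    \<open>Phi\<close>.\<close>
  have W0: "0 \<le> W"
    unfolding W_def using finite_cube l1
    by (rule linear_part_nonneg) (simp add: Q Q_mono)
  have "W \<le> (\<Sum>\<alpha> | \<alpha> \<in> cube m n \<and> num_nonzero n \<alpha> = 1. \<bar>F f \<alpha> * F g \<alpha>\<bar>)"
    unfolding W_def by (intro sum_mono) simp
  also have "\<dots> \<le> (\<Sum>\<alpha>\<in>cube m n. \<bar>F f \<alpha> * F g \<alpha>\<bar>)"
    by (intro sum_mono2 finite_cube) auto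
  finally have W1: "W \<le> 1" using l1 by simp
  \<comment> \<open>The role of \<open>M\<close> is played by the covariance
    \<open>Q f g 1 - Q f g 0\<close>; monotonicity of \<open>Q f g\<close> makes it bound every
    increment from 0 on \<open>[0, 1]\<close>.\<close>
  have "1 / 65536 * Phi W \<le> Q f g 1 - Q f g 0"
  proof (rule Phi_le_of_quadratic_bounds[OF W0 W1])
    show "0 \<le> Q f g 1 - Q f g 0" using Q_mono[of 0 1] by simp
    show "W \<le> 8 * (real d)\<^sup>2 * (Q f g 1 - Q f g 0 + (1 / 2) ^ d)" if "d \<ge> 1" for d
      unfolding W_def
    proof (rule linear_part_le[OF finite_cube l1 _ that])
      fix t :: real assume "0 \<le> t" "t \<le> 1"
      then show "\<bar>(\<Sum>\<alpha>\<in>cube m n. F f \<alpha> * F g \<alpha> * t ^ num_nonzero n \<alpha>)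
          - (\<Sum>\<alpha>\<in>cube m n. F f \<alpha> * F g \<alpha> * 0 ^ num_nonzero n \<alpha>)\<bar> \<le> Q f g 1 - Q f g 0"
        using Q_mono[of 0 t] Q_mono[of t 1] by (simp add: Q)
    qed
  qed
  then have "W \<in> {0..1} \<and> E (\<lambda>x. f x * g x) - E f * E g \<ge> (1 / 65536) * Phi W"
    using W0 W1 by (simp add: Q0 Q1)
  then show "let E = measure_pmf.expectation (cube_pmf n p);
           W = (\<Sum>\<alpha> | \<alpha> \<in> cube m n \<and> num_nonzero n \<alpha> = 1.
                  fourier_coeff n p \<phi> f \<alpha> * fourier_coeff n p \<phi> g \<alpha>)
       in W \<in> {0..1} \<and> E (\<lambda>x. f x * g x) - E f * E g \<ge> (1 / 65536) * Phi W"
    unfolding Let_def W_def E_def F_def .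
qed simp

end
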